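(* In the setting of the context, suppose the infinitesimal generator $$G(\cdot\mid x,a,\mu)=\lim_{h\to0}\frac{p_h(\cdot\mid x,a,\mu)-\mathbf{1}_x}{h}$$ exists and is uniformly bounded, i.e. $|G(x'\mid x,a,\mu)|$ is bounded over all $(x',x,a,\mu)\in\mathcal{X}\times\mathcal{X}\times\mathcal{A}\times\mathcal{P}(\mathcal{X})$, where $\mathbf{1}_x$ is the unit point mass at $x$. Suppose also that $f$ is uniformly bounded over $\mathcal{X}\times\mathcal{A}\times\mathcal{P}(\mathcal{X})$. Then, for the one-step dynamics $x'\sim p_h(\cdot\mid x,a,\mu)$, for every policy $\alpha$, every $(x,a)\in\mathcal{X}\times\mathcal{A}$ and (in the MFG case) every fixed $\mu\in\mathcal{P}(\mathcal{X})$, for sufficiently small $h>0$, $$Q^{\mu,\alpha}_{h,\mathrm{MFG}}(x,a)=V^{\mu,\alpha}_{h,\mathrm{MFG}}(x)+O(h),\qquad Q^{\alpha}_{h,\mathrm{MFC}}(x,a)=V^{\alpha}_{h,\mathrm{MFC}}(x)+O(h).$$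
   Context: $\mathcal{X},\mathcal{A}$ are finite sets (states, actions), $\mathcal{P}(\mathcal{X})$ is the set of probability measures on $\mathcal{X}$, $\gamma>0$ is fixed, $f:\mathcal{X}\times\mathcal{A}\times\mathcal{P}(\mathcal{X})\to\mathbb{R}_+$ is a running cost, and for each time step $h>0$, $p_h(\cdot\mid x,a,\mu)\in\mathcal{P}(\mathcal{X})$ is the one-step transition probability. A policy is a map $\alpha:\mathcal{X}\to\mathcal{A}$. $\mathcal{P}[X]$ denotes the law of $X$. MFG: for fixed $\mu$, $(X_k^{\alpha,\mu})$ is the chain with $X_{k+1}\sim p_h(\cdot\mid X_k,\alpha_k,\mu)$, $\alpha_k=\alpha(X_k)$ (when conditioning on $\alpha_0=a$, the action $a$ is used at step $0$ and $\alpha(X_k)$ for $k\ge1$), and $$V^{\mu,\alpha}_{h,\mathrm{MFG}}(x)=\mathbb{E}\Big[h\sum_{k=0}^\infty e^{-k\gamma h}f(X_k^{\alpha,\mu},\alpha_k,\mu)\Big|X_0=x\Big],$$ $$Q^{\mu,\alpha}_{h,\mathrm{MFG}}(x,a)=\mathbb{E}\Big[h\sum_{k=0}^\infty e^{-k\gamma h}f(X_k^{\alpha,\mu},\alpha_k,\mu)\Big|X_0=x,\alpha_0=a\Big].$$ MFC (asymptotic): for each policy $\alpha$, $\mu^\alpha=\lim_{k\to\infty}\mathcal{P}[X_k^\alpha]$ is the limiting law (assumed to exist) of the chain with $X_{k+1}^\alpha\sim p_h(\cdot\mid X_k^\alpha,\alpha(X_k^\alpha),\mu^\alpha)$ started from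 a given initial law, and $$V^\alpha_{h,\mathrm{MFC}}(x)=\mathbb{E}\Big[h\sum_{k=0}^\infty e^{-k\gamma h}f(X_k^\alpha,\alpha_k,\mu^\alpha)\Big|X_0=x\Big],$$ $$Q^\alpha_{h,\mathrm{MFC}}(x,a)=hf(x,a,\mu^{\tilde\alpha})+\mathbb{E}\Big[h\sum_{k=1}^\infty e^{-k\gamma h}f(X_k^\alpha,\alpha_k,\mu^\alpha)\Big|X_0=x,\alpha_0=a\Big],$$ where the modified policy $\tilde\alpha$ (depending on $(x,a)$) is $\tilde\alpha(s)=\alpha(s)$ for $s\ne x$ and $\tilde\alpha(x)=a$. In the last expectation $X_1\sim p_h(\cdot\mid x,a,\mu^\alpha)$ and afterwards $\alpha_k=\alpha(X_k^\alpha)$.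
   Formalization: For MFC, the limit defining G is also assumed uniform over the laws μ^α as h varies, for each policy α; since μ^α depends on h, convergence for each fixed μ alone does not suffice (a two-state counterexample exists). *)

theory Defs
  imports "HOL-Probability.Probability"
begin

(* Law on path space of the chain started from nu, in which at time k the action
   pi k (omega k) is used and the next state is drawn from K (omega k) (pi k (omega k)).
   Time-dependent decision rules are needed because the Q-functions use a different
   action at time 0. *)

definition chain_kernel ::
    "('x \<Rightarrow> 'a \<Rightarrow> 'x pmf) \<Rightarrow> (nat \<Rightarrow> 'x \<Rightarrow> 'a) \<Rightarrow> 'x pmf \<Rightarrow> nat \<Rightarrow> (nat \<Rightarrow> 'x) \<Rightarrow> 'x measure" where
  "chain_kernel K \<pi> \<nu> n \<omega> =
     measure_pmf (case n of 0 \<Rightarrow> \<nu> | Suc k \<Rightarrow> K (\<omega> k) (\<pi> k (\<omega> k)))"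

definition chain_measure ::
    "('x \<Rightarrow> 'a \<Rightarrow> 'x pmf) \<Rightarrow> (nat \<Rightarrow> 'x \<Rightarrow> 'a) \<Rightarrow> 'x pmf \<Rightarrow> (nat \<Rightarrow> 'x) measure" where
  "chain_measure K \<pi> \<nu> =
     projective_family.lim UNIV
       (Ionescu_Tulcea.CI (chain_kernel K \<pi> \<nu>) (\<lambda>_. count_space UNIV))
       (\<lambda>_. count_space UNIV)"

lemma Ionescu_Tulcea_chain_kernel:
  fixes K :: "'x::finite \<Rightarrow> 'a \<Rightarrow> 'x pmf"
  shows "Ionescu_Tulcea (chain_kernel K \<pi> \<nu>) (\<lambda>_. count_space UNIV)"
proof (rule Ionescu_Tulcea.intro)
  fix i :: nat
  have "sets (PiM {0..<i} (\<lambda>_. count_space (UNIV :: 'x set)))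
      = sets (count_space (PiE {0..<i} (\<lambda>_. UNIV)))"
    by (subst count_space_PiM_finite) auto
  then have "measurable (PiM {0..<i} (\<lambda>_. count_space (UNIV :: 'x set))) N
      = measurable (count_space (PiE {0..<i} (\<lambda>_. UNIV))) N" for N :: "'x measure measure"
    by (rule measurable_cong_sets) simp
  then show "chain_kernel K \<pi> \<nu> i
      \<in> measurable (PiM {0..<i} (\<lambda>_. count_space UNIV)) (subprob_algebra (count_space UNIV))"
    by (auto simp: chain_kernel_def space_subprob_algebra measure_pmf.subprob_space_axioms)
next
  fix i :: nat and \<omega> :: "nat \<Rightarrow> 'x"
  show "prob_space (chain_kernel K \<pi> \<nu> i \<omega>)"
    by (simp add: chain_kernel_def measure_pmf.prob_space_axioms)
qed

lemma emeasure_chain_measure_cylinder: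
  fixes K :: "'x::finite \<Rightarrow> 'a \<Rightarrow> 'x pmf"
  shows "emeasure (chain_measure K \<pi> \<nu>) {\<omega>. \<forall>i\<le>n. \<omega> i = s i}
    = ennreal (pmf \<nu> (s 0) * (\<Prod>k<n. pmf (K (s k) (\<pi> k (s k))) (s (Suc k))))"
proof -
  let ?M = "\<lambda>_::nat. count_space (UNIV :: 'x set)"
  interpret IT: Ionescu_Tulcea "chain_kernel K \<pi> \<nu>" ?M
    by (rule Ionescu_Tulcea_chain_kernel)
  let ?r = "\<lambda>n. restrict s {0..<n}"
  have sets_PiM: "sets (PiM {0..<n} ?M) = Pow (PiE {0..<n} (\<lambda>_. UNIV))" for n :: nat
    by (subst count_space_PiM_finite) auto
  have sp: "space (PiM {0..<n} ?M) = PiE {0..<n} (\<lambda>_. UNIV)" for n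
    by (simp add: space_PiM)
  have in_sets: "{?r n} \<in> sets (PiM {0..<n} ?M)" for n
    by (auto simp: sets_PiM)
  have C: "emeasure (IT.C 0 (Suc n) (\<lambda>_. undefined)) {?r (Suc n)}
      = ennreal (pmf \<nu> (s 0) * (\<Prod>k<n. pmf (K (s k) (\<pi> k (s k))) (s (Suc k))))"
  proof -
    define w where "w j = (case j of 0 \<Rightarrow> pmf \<nu> (s 0) | Suc k \<Rightarrow> pmf (K (s k) (\<pi> k (s k))) (s (Suc k)))" for j
    have "emeasure (IT.C 0 m (\<lambda>_. undefined)) {?r m} = ennreal (\<Prod>j<m. w j)" for m
    proof (induction m)
      case 0
      have "(\<lambda>_::nat. undefined :: 'x) = ?r 0" by (auto simp: fun_eq_iff)
      with in_sets[of 0] show ?case by (simp add: emeasure_return indicator_def)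
    next
      case (Suc m)
      have und: "(\<lambda>_. undefined) \<in> space (PiM {0..<0} ?M)" by (simp add: space_PiM)
      have eq: "emeasure (IT.eP m \<omega>) {?r (Suc m)} = ennreal (w m) * indicator {?r m} \<omega>"
        if \<omega>: "\<omega> \<in> space (PiM {0..<m} ?M)" for \<omega>
      proof -
        have "fun_upd \<omega> m -` {?r (Suc m)} = (if \<omega> = ?r m then {s m} else {})"
        proof -
          have "fun_upd \<omega> m x = ?r (Suc m) \<longleftrightarrow> \<omega> = ?r m \<and> x = s m" for x
            using \<omega> by (auto simp: sp PiE_iff extensional_def fun_eq_iff restrict_def)
          then show ?thesis by auto
        qed
        moreover have "chain_kernel K \<pi> \<nu> m (?r m) {s m} = ennreal (w m)"
          by (cases m) (auto simp: chain_kernel_def w_def emeasure_pmf_single)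
        ultimately show ?thesis
          by (subst IT.emeasure_eP[OF \<omega> in_sets]) (auto simp: indicator_def)
      qed
      have "emeasure (IT.C 0 (Suc m) (\<lambda>_. undefined)) {?r (Suc m)}
          = (\<integral>\<^sup>+\<omega>. emeasure (IT.eP m \<omega>) {?r (Suc m)} \<partial>IT.C 0 m (\<lambda>_. undefined))"
        using IT.measurable_eP[of m] und in_sets[of "Suc m"] prob_space.not_empty[OF IT.prob_space_C[OF und]]
        by (simp add: emeasure_bind[where N="PiM {0..<Suc m} ?M"] measurable_cong_sets[OF IT.sets_C[OF und]])
      also have "\<dots> = (\<integral>\<^sup>+\<omega>. ennreal (w m) * indicator {?r m} \<omega> \<partial>IT.C 0 m (\<lambda>_. undefined))"
        using IT.space_C[OF und, of m] by (intro nn_integral_cong eq) simp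
      also have "\<dots> = ennreal (w m) * emeasure (IT.C 0 m (\<lambda>_. undefined)) {?r m}"
        using IT.sets_C[OF und, of m] in_sets[of m] by (subst nn_integral_cmult_indicator) auto
      also have "\<dots> = ennreal (\<Prod>j<Suc m. w j)"
        unfolding Suc.IH by (subst ennreal_mult[symmetric]) (auto simp: w_def mult.commute split: nat.split intro!: prod_nonneg)
      finally show ?case .
    qed
    from this[of "Suc n"] show ?thesis
      by (simp add: w_def prod.lessThan_Suc_shift del: prod.lessThan_Suc)
  qed
  have "{\<omega>. \<forall>i\<le>n. \<omega> i = s i} = prod_emb UNIV ?M {0..<Suc n} {?r (Suc n)}"
    by (auto simp: prod_emb_def restrict_def fun_eq_iff less_Suc_eq_le split: if_splits)
  then have "emeasure (chain_measure K \<pi> \<nu>) {\<omega>. \<forall>i\<le>n. \<omega> i = s i}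
      = emeasure (IT.CI {0..<Suc n}) {?r (Suc n)}"
    unfolding chain_measure_def by (simp add: IT.lim[OF _ in_sets])
  also have "\<dots> = emeasure (IT.C 0 (Suc n) (\<lambda>_. undefined)) {?r (Suc n)}"
    using in_sets[of "Suc n"] sp[of "Suc n"]
    by (subst IT.emeasure_CI[of _ "Suc n"]) (auto simp: prod_emb_id)
  finally show ?thesis unfolding C .
qed

definition V_MFG ::
    "(real \<Rightarrow> 'x \<Rightarrow> 'a \<Rightarrow> 'x pmf \<Rightarrow> 'x pmf) \<Rightarrow> ('x \<Rightarrow> 'a \<Rightarrow> 'x pmf \<Rightarrow> real) \<Rightarrow> real \<Rightarrow> real
      \<Rightarrow> 'x pmf \<Rightarrow> ('x \<Rightarrow> 'a) \<Rightarrow> 'x \<Rightarrow> real" where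
  "V_MFG p f \<gamma> h \<mu> \<alpha> x =
     (\<integral>\<omega>. h * (\<Sum>k. exp (- (real k * \<gamma> * h)) * f (\<omega> k) (\<alpha> (\<omega> k)) \<mu>)
        \<partial>chain_measure (\<lambda>y b. p h y b \<mu>) (\<lambda>_. \<alpha>) (return_pmf x))"

definition first_action :: "'a \<Rightarrow> ('x \<Rightarrow> 'a) \<Rightarrow> nat \<Rightarrow> 'x \<Rightarrow> 'a" where
  "first_action a \<alpha> k y = (if k = 0 then a else \<alpha> y)"

definition Q_MFG ::
    "(real \<Rightarrow> 'x \<Rightarrow> 'a \<Rightarrow> 'x pmf \<Rightarrow> 'x pmf) \<Rightarrow> ('x \<Rightarrow> 'a \<Rightarrow> 'x pmf \<Rightarrow> real) \<Rightarrow> real \<Rightarrow> real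
      \<Rightarrow> 'x pmf \<Rightarrow> ('x \<Rightarrow> 'a) \<Rightarrow> 'x \<Rightarrow> 'a \<Rightarrow> real" where
  "Q_MFG p f \<gamma> h \<mu> \<alpha> x a =
     (\<integral>\<omega>. h * (\<Sum>k. exp (- (real k * \<gamma> * h)) * f (\<omega> k) (first_action a \<alpha> k (\<omega> k)) \<mu>)
        \<partial>chain_measure (\<lambda>y b. p h y b \<mu>) (first_action a \<alpha>) (return_pmf x))"

(* mu is a fixed point: the chain whose transitions use mu itself has limiting law mu.
   Such a mu need not be unique. *)

definition limiting_law ::
    "('x \<Rightarrow> 'a \<Rightarrow> 'x pmf \<Rightarrow> 'x pmf) \<Rightarrow> 'x pmf \<Rightarrow> ('x \<Rightarrow> 'a) \<Rightarrow> 'x pmf \<Rightarrow> bool" where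
  "limiting_law q \<nu>0 \<alpha> \<mu> \<longleftrightarrow>
     (\<forall>y. (\<lambda>k. measure (chain_measure (\<lambda>z b. q z b \<mu>) (\<lambda>_. \<alpha>) \<nu>0) {\<omega>. \<omega> k = y})
            \<longlonglongrightarrow> pmf \<mu> y)"

(* In the MFC functions, m maps each policy to its limiting law for the time step h.
   Conditioning on X_0 = x means starting the chain at x, with the law m \<alpha> held fixed. *)

definition V_MFC ::
    "(real \<Rightarrow> 'x \<Rightarrow> 'a \<Rightarrow> 'x pmf \<Rightarrow> 'x pmf) \<Rightarrow> ('x \<Rightarrow> 'a \<Rightarrow> 'x pmf \<Rightarrow> real) \<Rightarrow> real \<Rightarrow> real
      \<Rightarrow> (('x \<Rightarrow> 'a) \<Rightarrow> 'x pmf) \<Rightarrow> ('x \<Rightarrow> 'a) \<Rightarrow> 'x \<Rightarrow> real" where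
  "V_MFC p f \<gamma> h m \<alpha> x =
     (\<integral>\<omega>. h * (\<Sum>k. exp (- (real k * \<gamma> * h)) * f (\<omega> k) (\<alpha> (\<omega> k)) (m \<alpha>))
        \<partial>chain_measure (\<lambda>y b. p h y b (m \<alpha>)) (\<lambda>_. \<alpha>) (return_pmf x))"

definition Q_MFC ::
    "(real \<Rightarrow> 'x \<Rightarrow> 'a \<Rightarrow> 'x pmf \<Rightarrow> 'x pmf) \<Rightarrow> ('x \<Rightarrow> 'a \<Rightarrow> 'x pmf \<Rightarrow> real) \<Rightarrow> real \<Rightarrow> real
      \<Rightarrow> (('x \<Rightarrow> 'a) \<Rightarrow> 'x pmf) \<Rightarrow> ('x \<Rightarrow> 'a) \<Rightarrow> 'x \<Rightarrow> 'a \<Rightarrow> real" where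
  "Q_MFC p f \<gamma> h m \<alpha> x a =
     h * f x a (m (\<alpha>(x := a))) +
     (\<integral>\<omega>. h * (\<Sum>k. exp (- (real (Suc k) * \<gamma> * h))
                      * f (\<omega> (Suc k)) (first_action a \<alpha> (Suc k) (\<omega> (Suc k))) (m \<alpha>))
        \<partial>chain_measure (\<lambda>y b. p h y b (m \<alpha>)) (first_action a \<alpha>) (return_pmf x))"

(* The generator G is the limit of this quotient as h tends to 0 from the right.
   In the MFC problem the law at which the quotient is evaluated may itself depend on h,
   and convergence for each fixed mu then does not control p_h - 1_x. There the limit has to
   be uniform over the limiting laws of a policy as h varies. If these laws do not depend
   on h, they form a singleton and this is again convergence for fixed mu; it also follows
   from convergence that is uniform over all probability measures. *)

definition generator_quotient ::
    "(real \<Rightarrow> 'x \<Rightarrow> 'a \<Rightarrow> 'x pmf \<Rightarrow> 'x pmf) \<Rightarrow> 'x \<Rightarrow> 'x \<Rightarrow> 'a \<Rightarrow> real \<Rightarrow> 'x pmf \<Rightarrow> real" where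
  "generator_quotient p x' x a h \<mu> = (pmf (p h x a \<mu>) x' - pmf (return_pmf x) x') / h"

end

theory Submission
  imports Defs
begin

text \<open>Splitting off time \<open>0\<close> gives \<open>V(x) = h (f(x, \<alpha> x) + c(p\<^sub>h(x, \<alpha> x)))\<close> and
  \<open>Q(x, a) = h (f(x, a) + c(p\<^sub>h(x, a)))\<close>, where \<open>c(\<nu>)\<close> is the discounted running cost
  collected after time \<open>0\<close>, without the factor \<open>h\<close>, when \<open>X\<^sub>1\<close> has law \<open>\<nu>\<close> and the policy is
  followed from then on. The running costs at time \<open>0\<close> contribute \<open>O(h)\<close> to the difference.
  In the MFC problem the one in \<open>Q\<close> is taken at the limiting law of the modified policy, which
  is harmless because \<open>f\<close> is bounded uniformly over all laws.

  With \<open>C\<close> a bound of \<open>f\<close>, the sum \<open>c\<close> can be as large as \<open>C / (\<gamma> h)\<close>, up to a factor that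
  tends to \<open>1\<close>, so the factor \<open>h\<close> alone does not suffice for the remaining terms. But \<open>c\<close> is
  linear in \<open>\<nu>\<close>, so \<open>\<bar>c(\<nu>) - c(\<nu>')\<bar>\<close> is at most \<open>C / (\<gamma> h)\<close> times the \<open>l\<^sup>1\<close> distance of the two laws (\<open>cost_to_go_diff_le\<close>).
  Both \<open>p\<^sub>h(x, a)\<close> and \<open>p\<^sub>h(x, \<alpha> x)\<close> are within \<open>O(h)\<close> of the point mass at \<open>x\<close>, since the
  generator is bounded (\<open>eventually_one_step_le\<close>). Hence \<open>c(p\<^sub>h(x, a)) - c(p\<^sub>h(x, \<alpha> x))\<close> is
  bounded as \<open>h\<close> tends to \<open>0\<close>, and the outer factor \<open>h\<close> finishes the estimate
  (\<open>Q_minus_V_le\<close>). In the MFC problem the law in the transition kernel moves with \<open>h\<close>; the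
  uniform convergence of the generator quotient keeps the bound on \<open>p\<^sub>h\<close> independent of it.

  Costs are sums over times of functions of the state at one time, so the path measure enters
  only through its one-time marginals (\<open>distr_chain_measure_component\<close>).\<close>

section \<open>One-time marginals of the chain\<close>

primrec chain_law ::
    "('x \<Rightarrow> 'a \<Rightarrow> 'x pmf) \<Rightarrow> (nat \<Rightarrow> 'x \<Rightarrow> 'a) \<Rightarrow> 'x pmf \<Rightarrow> nat \<Rightarrow> 'x pmf" where
  "chain_law K \<pi> \<nu> 0 = \<nu>"
| "chain_law K \<pi> \<nu> (Suc k) = bind_pmf (chain_law K \<pi> \<nu> k) (\<lambda>z. K z (\<pi> k z))"

lemma sets_chain_measure [measurable_cong]:
  fixes K :: "'x::finite \<Rightarrow> 'a \<Rightarrow> 'x pmf"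
  shows "sets (chain_measure K \<pi> \<nu>) = sets (PiM UNIV (\<lambda>_. count_space UNIV))"
proof -
  interpret IT: Ionescu_Tulcea "chain_kernel K \<pi> \<nu>" "\<lambda>_. count_space UNIV"
    by (rule Ionescu_Tulcea_chain_kernel)
  show ?thesis
    unfolding chain_measure_def by simp
qed

lemma space_chain_measure [simp]:
  fixes K :: "'x::finite \<Rightarrow> 'a \<Rightarrow> 'x pmf"
  shows "space (chain_measure K \<pi> \<nu>) = UNIV"
  using sets_eq_imp_space_eq[OF sets_chain_measure[of K \<pi> \<nu>]] by (simp add: space_PiM)

lemma measurable_chain_measure_component [measurable]:
  fixes K :: "'x::finite \<Rightarrow> 'a \<Rightarrow> 'x pmf"
  shows "(\<lambda>\<omega>. \<omega> i) \<in> measurable (chain_measure K \<pi> \<nu>) (count_space UNIV)"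
  by (subst measurable_cong_sets[OF sets_chain_measure refl]) simp

lemma sets_chain_measure_segment:
  fixes K :: "'x::finite \<Rightarrow> 'a \<Rightarrow> 'x pmf"
  shows "{\<omega>. \<forall>i\<in>{j..n}. \<omega> i = s i} \<in> sets (chain_measure K \<pi> \<nu>)"
proof -
  have "{\<omega> \<in> space (chain_measure K \<pi> \<nu>). \<forall>i\<in>{j..n}. \<omega> i = s i} \<in> sets (chain_measure K \<pi> \<nu>)"
    by measurable
  then show ?thesis by simp
qed

lemma prob_space_chain_measure:
  fixes K :: "'x::finite \<Rightarrow> 'a \<Rightarrow> 'x pmf"
  shows "prob_space (chain_measure K \<pi> \<nu>)"
proof
  let ?M = "chain_measure K \<pi> \<nu>"
  have "emeasure ?M (\<Union>y. {\<omega>. \<omega> 0 = y}) = (\<Sum>y\<in>UNIV. emeasure ?M {\<omega>. \<omega> 0 = y})"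
    using sets_chain_measure_segment[of 0 0 "\<lambda>_. y" for y]
    by (intro sum_emeasure[symmetric]) (auto simp: disjoint_family_on_def)
  also have "\<dots> = (\<Sum>y\<in>UNIV. ennreal (pmf \<nu> y))"
    using emeasure_chain_measure_cylinder[of K \<pi> \<nu> 0 "\<lambda>_. y" for y] by simp
  also have "\<dots> = 1"
    using sum_pmf_eq_1[of "UNIV" \<nu>] by simp
  finally show "emeasure ?M (space ?M) = 1"
    by (simp flip: Collect_ex_eq)
qed

lemma pmf_bind_finite:
  fixes p :: "'x::finite pmf"
  shows "pmf (bind_pmf p q) y = (\<Sum>z\<in>UNIV. pmf p z * pmf (q z) y)"
  by (simp add: pmf_bind integral_measure_pmf_real[of UNIV] mult.commute)

text \<open>Raising the lower end \<open>j\<close> of the time segment sums a full cylinder over its early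
  coordinates, one at a time, and each summation is one step of \<open>chain_law\<close>. The case
  \<open>j = n\<close> is the marginal at time \<open>n\<close>.\<close>

lemma measure_chain_measure_segment:
  fixes K :: "'x::finite \<Rightarrow> 'a \<Rightarrow> 'x pmf"
  assumes "j \<le> n"
  shows "measure (chain_measure K \<pi> \<nu>) {\<omega>. \<forall>i\<in>{j..n}. \<omega> i = s i}
    = pmf (chain_law K \<pi> \<nu> j) (s j) * (\<Prod>k=j..<n. pmf (K (s k) (\<pi> k (s k))) (s (Suc k)))"
  using assms
proof (induction j arbitrary: s)
  case 0
  have "emeasure (chain_measure K \<pi> \<nu>) {\<omega>. \<forall>i\<in>{0..n}. \<omega> i = s i}
      = ennreal (pmf \<nu> (s 0) * (\<Prod>k<n. pmf (K (s k) (\<pi> k (s k))) (s (Suc k))))"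
    using emeasure_chain_measure_cylinder[of K \<pi> \<nu> n s] by (simp add: Ball_def)
  then show ?case
    by (simp add: measure_def prod_nonneg lessThan_atLeast0)
next
  case (Suc j)
  let ?M = "chain_measure K \<pi> \<nu>"
  interpret prob_space ?M by (rule prob_space_chain_measure)
  define t where "t z = s(j := z)" for z
  define A where "A z = {\<omega>. \<forall>i\<in>{j..n}. \<omega> i = t z i}" for z
  have "{\<omega>. \<forall>i\<in>{Suc j..n}. \<omega> i = s i} = (\<Union>z. A z)"
    using Suc.prems by (force simp: A_def t_def)
  moreover have "measure ?M (\<Union>z. A z) = (\<Sum>z\<in>UNIV. measure ?M (A z))"
  proof (intro finite_measure_finite_Union)
    have "A z \<in> sets ?M" for z
      unfolding A_def by (rule sets_chain_measure_segment)
    then show "range A \<subseteq> sets ?M" by auto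
    show "disjoint_family A"
      using Suc.prems by (fastforce simp: disjoint_family_on_def A_def t_def)
  qed simp
  moreover have "measure ?M (A z) = pmf (chain_law K \<pi> \<nu> j) z * pmf (K z (\<pi> j z)) (s (Suc j))
      * (\<Prod>k=Suc j..<n. pmf (K (s k) (\<pi> k (s k))) (s (Suc k)))" for z
  proof -
    have "measure ?M (A z) = pmf (chain_law K \<pi> \<nu> j) (t z j)
        * (\<Prod>k=j..<n. pmf (K (t z k) (\<pi> k (t z k))) (t z (Suc k)))"
      unfolding A_def using Suc.prems by (intro Suc.IH) simp
    also have "(\<Prod>k=j..<n. pmf (K (t z k) (\<pi> k (t z k))) (t z (Suc k)))
        = pmf (K z (\<pi> j z)) (s (Suc j)) * (\<Prod>k=Suc j..<n. pmf (K (s k) (\<pi> k (s k))) (s (Suc k)))"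
      using Suc.prems by (subst prod.atLeast_Suc_lessThan) (auto simp: t_def intro!: prod.cong)
    finally show ?thesis by (simp add: t_def mult.assoc)
  qed
  ultimately show ?case
    by (simp add: pmf_bind_finite sum_distrib_right)
qed

lemma distr_chain_measure_component:
  fixes K :: "'x::finite \<Rightarrow> 'a \<Rightarrow> 'x pmf"
  shows "distr (chain_measure K \<pi> \<nu>) (count_space UNIV) (\<lambda>\<omega>. \<omega> k) = measure_pmf (chain_law K \<pi> \<nu> k)"
proof (rule measure_eqI_finite)
  let ?M = "chain_measure K \<pi> \<nu>"
  interpret prob_space ?M by (rule prob_space_chain_measure)
  fix y :: 'x
  have "measure ?M {\<omega>. \<omega> k = y} = pmf (chain_law K \<pi> \<nu> k) y"
    using measure_chain_measure_segment[of k k K \<pi> \<nu> "\<lambda>_. y"] by simp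
  then show "emeasure (distr ?M (count_space UNIV) (\<lambda>\<omega>. \<omega> k)) {y}
      = emeasure (measure_pmf (chain_law K \<pi> \<nu> k)) {y}"
    by (subst emeasure_distr) (auto simp: emeasure_pmf_single emeasure_eq_measure vimage_def)
qed auto

text \<open>The law is defined by its last step; conditioning on the action at time \<open>0\<close> requires
  its first step.\<close>

lemma chain_law_Suc_shift:
  "chain_law K \<pi> \<nu> (Suc k)
    = chain_law K (\<lambda>i. \<pi> (Suc i)) (bind_pmf \<nu> (\<lambda>z. K z (\<pi> 0 z))) k"
  by (induction k) simp_all

lemma chain_law_bind_initial:
  "chain_law K \<pi> \<nu> k = bind_pmf \<nu> (\<lambda>z. chain_law K \<pi> (return_pmf z) k)"
  by (induction k) (simp_all add: bind_return_pmf' bind_assoc_pmf)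

section \<open>Discounted costs as series of one-time expectations\<close>

lemma summable_weighted_bounded:
  fixes w e :: "nat \<Rightarrow> real"
  assumes "summable w" "\<And>k. 0 \<le> w k" "\<And>k. \<bar>e k\<bar> \<le> C"
  shows "summable (\<lambda>k. w k * e k)"
proof (rule summable_comparison_test')
  show "summable (\<lambda>k. w k * C)"
    using assms(1) by (rule summable_mult2)
  show "norm (w k * e k) \<le> w k * C" for k
    using assms(2)[of k] assms(3)[of k] by (simp add: abs_mult mult_left_mono)
qed

lemma abs_expectation_pmf_le:
  fixes g :: "'x::finite \<Rightarrow> real"
  assumes "\<And>y. \<bar>g y\<bar> \<le> C"
  shows "\<bar>measure_pmf.expectation q g\<bar> \<le> C"
proof -
  have "\<bar>measure_pmf.expectation q g\<bar> \<le> (\<Sum>y\<in>UNIV. \<bar>g y * pmf q y\<bar>)"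
    by (simp add: integral_measure_pmf_real[of UNIV])
  also have "\<dots> \<le> (\<Sum>y\<in>UNIV. C * pmf q y)"
    by (intro sum_mono) (auto simp: abs_mult intro!: mult_right_mono assms)
  also have "\<dots> = C"
    by (simp add: sum_distrib_left[symmetric] sum_pmf_eq_1)
  finally show ?thesis .
qed

text \<open>The expectation is linear in the initial law, with coefficients bounded by \<open>C\<close>. The
  bound does not grow with the time \<open>k\<close>, so it survives summation against the discount.\<close>

lemma expectation_chain_law_diff_le:
  fixes g :: "'x::finite \<Rightarrow> real"
  assumes "\<And>y. \<bar>g y\<bar> \<le> C"
  shows "\<bar>measure_pmf.expectation (chain_law K \<pi> \<nu> k) g
      - measure_pmf.expectation (chain_law K \<pi> \<nu>' k) g\<bar> \<le> C * (\<Sum>z\<in>UNIV. \<bar>pmf \<nu> z - pmf \<nu>' z\<bar>)"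
proof -
  define e where "e z = measure_pmf.expectation (chain_law K \<pi> (return_pmf z) k) g" for z
  have E: "measure_pmf.expectation (chain_law K \<pi> q k) g = (\<Sum>z\<in>UNIV. pmf q z * e z)" for q
    by (subst chain_law_bind_initial) (simp add: pmf_expectation_bind[of UNIV] e_def)
  have "\<bar>(\<Sum>z\<in>UNIV. pmf \<nu> z * e z) - (\<Sum>z\<in>UNIV. pmf \<nu>' z * e z)\<bar>
      = \<bar>\<Sum>z\<in>UNIV. (pmf \<nu> z - pmf \<nu>' z) * e z\<bar>"
    by (simp add: sum_subtractf algebra_simps)
  also have "\<dots> \<le> (\<Sum>z\<in>UNIV. \<bar>(pmf \<nu> z - pmf \<nu>' z) * e z\<bar>)"
    by (rule sum_abs)
  also have "\<dots> \<le> (\<Sum>z\<in>UNIV. \<bar>pmf \<nu> z - pmf \<nu>' z\<bar> * C)"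
    unfolding abs_mult e_def by (intro sum_mono mult_left_mono abs_expectation_pmf_le assms) auto
  finally show ?thesis by (simp add: E sum_distrib_left mult.commute)
qed

text \<open>Integral and series are exchanged by dominated convergence. The time map \<open>t\<close> covers
  costs that are counted from time \<open>1\<close> on.\<close>

lemma integral_suminf_chain_measure:
  fixes K :: "'x::finite \<Rightarrow> 'a \<Rightarrow> 'x pmf" and w :: "nat \<Rightarrow> real" and g :: "nat \<Rightarrow> 'x \<Rightarrow> real"
  assumes w: "summable w" "\<And>k. 0 \<le> w k" and g: "\<And>k y. \<bar>g k y\<bar> \<le> C"
  shows "(\<integral>\<omega>. (\<Sum>k. w k * g k (\<omega> (t k))) \<partial>chain_measure K \<pi> \<nu>)
    = (\<Sum>k. w k * measure_pmf.expectation (chain_law K \<pi> \<nu> (t k)) (g k))"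
proof -
  let ?M = "chain_measure K \<pi> \<nu>"
  interpret prob_space ?M by (rule prob_space_chain_measure)
  have m: "(\<lambda>\<omega>. g k (\<omega> (t k))) \<in> borel_measurable ?M" for k
    by (rule measurable_compose[of _ _ "count_space UNIV"]) auto
  have i: "integrable ?M (\<lambda>\<omega>. g k (\<omega> (t k)))" for k
    using g m by (intro integrable_const_bound[where B = C]) auto
  have C: "0 \<le> C" using g[of 0 undefined] by linarith
  have b: "norm (w k * g k y) \<le> w k * C" for k y
    using w(2) g by (auto simp: abs_mult intro!: mult_left_mono)
  have sC: "summable (\<lambda>k. w k * C)" by (intro summable_mult2 w)
  have E: "(\<integral>\<omega>. w k * g k (\<omega> (t k)) \<partial>?M)
      = w k * measure_pmf.expectation (chain_law K \<pi> \<nu> (t k)) (g k)" for k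
    unfolding distr_chain_measure_component[symmetric]
    by (subst integral_distr) auto
  have "(\<integral>\<omega>. (\<Sum>k. w k * g k (\<omega> (t k))) \<partial>?M) = (\<Sum>k. (\<integral>\<omega>. w k * g k (\<omega> (t k)) \<partial>?M))"
  proof (rule integral_suminf)
    show "integrable ?M (\<lambda>\<omega>. w k * g k (\<omega> (t k)))" for k using i by simp
    show "AE \<omega> in ?M. summable (\<lambda>k. norm (w k * g k (\<omega> (t k))))"
      using b by (intro AE_I2 summable_comparison_test[OF _ sC]) auto
    show "summable (\<lambda>k. \<integral>\<omega>. norm (w k * g k (\<omega> (t k))) \<partial>?M)"
    proof (rule summable_comparison_test[OF _ sC], intro exI allI impI)
      fix k
      have "(\<integral>\<omega>. norm (w k * g k (\<omega> (t k))) \<partial>?M) \<le> (\<integral>\<omega>. w k * C \<partial>?M)"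
        using b i by (intro integral_mono) auto
      then show "norm (\<integral>\<omega>. norm (w k * g k (\<omega> (t k))) \<partial>?M) \<le> w k * C"
        using prob_space by (simp add: integral_nonneg)
    qed
  qed
  then show ?thesis by (simp only: E)
qed

section \<open>Dependence of the cost-to-go on the first action\<close>

text \<open>Here \<open>\<nu>\<close> is the law of the state at time \<open>1\<close> and the \<open>k\<close>-th summand is the cost at
  time \<open>k + 1\<close>, discounted to time \<open>0\<close> at rate \<open>\<rho> = \<gamma> h\<close> per step.\<close>

definition cost_to_go ::
    "real \<Rightarrow> ('x \<Rightarrow> 'a \<Rightarrow> 'x pmf) \<Rightarrow> ('x \<Rightarrow> 'a) \<Rightarrow> ('x \<Rightarrow> real) \<Rightarrow> 'x pmf \<Rightarrow> real" where
  "cost_to_go \<rho> K \<alpha> g \<nu> =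
     (\<Sum>k. exp (- (real (Suc k) * \<rho>)) * measure_pmf.expectation (chain_law K (\<lambda>_. \<alpha>) \<nu> k) g)"

lemma discount_sums:
  fixes \<rho> :: real
  assumes "\<rho> > 0"
  shows "summable (\<lambda>k. exp (- (real k * \<rho>)))"
    and "summable (\<lambda>k. exp (- (real (Suc k) * \<rho>)))"
    and "(\<Sum>k. exp (- (real (Suc k) * \<rho>))) \<le> 1 / \<rho>"
proof -
  have pow: "exp (- (real k * \<rho>)) = exp (- \<rho>) ^ k" for k
    by (simp add: exp_of_nat_mult[symmetric])
  have r: "norm (exp (- \<rho>)) < 1" using assms by simp
  show s: "summable (\<lambda>k. exp (- (real k * \<rho>)))"
    unfolding pow using r by (rule summable_geometric)
  then show "summable (\<lambda>k. exp (- (real (Suc k) * \<rho>)))"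
    by (subst summable_Suc_iff)
  have "(\<Sum>k. exp (- (real (Suc k) * \<rho>))) = exp (- \<rho>) * (1 / (1 - exp (- \<rho>)))"
    unfolding pow power_Suc using r by (simp add: suminf_mult suminf_geometric)
  also have "\<dots> = 1 / (exp \<rho> - 1)"
    using assms by (simp add: exp_minus field_simps)
  also have "\<dots> \<le> 1 / \<rho>"
    using assms exp_ge_add_one_self[of \<rho>] by (intro divide_left_mono) (linarith | simp)+
  finally show "(\<Sum>k. exp (- (real (Suc k) * \<rho>))) \<le> 1 / \<rho>" .
qed

lemma cost_to_go_diff_le:
  fixes K :: "'x::finite \<Rightarrow> 'a \<Rightarrow> 'x pmf"
  assumes \<rho>: "\<rho> > 0" and g: "\<And>y. \<bar>g y\<bar> \<le> C"
  shows "\<bar>cost_to_go \<rho> K \<alpha> g \<nu> - cost_to_go \<rho> K \<alpha> g \<nu>'\<bar>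
    \<le> C / \<rho> * (\<Sum>z\<in>UNIV. \<bar>pmf \<nu> z - pmf \<nu>' z\<bar>)"
proof -
  define w where "w k = exp (- (real (Suc k) * \<rho>))" for k
  define e where "e q k = measure_pmf.expectation (chain_law K (\<lambda>_. \<alpha>) q k) g" for q k
  define D where "D = C * (\<Sum>z\<in>UNIV. \<bar>pmf \<nu> z - pmf \<nu>' z\<bar>)"
  have C: "0 \<le> C" using g[of undefined] by linarith
  have D: "0 \<le> D" unfolding D_def using C by (simp add: sum_nonneg)
  have w: "summable w" "\<And>k. 0 \<le> w k" "suminf w \<le> 1 / \<rho>"
    using discount_sums[OF \<rho>] by (auto simp: w_def[abs_def] simp del: of_nat_Suc)
  have s: "summable (\<lambda>k. w k * e q k)" for q
    unfolding e_def by (rule summable_weighted_bounded[OF w(1,2) abs_expectation_pmf_le]) (rule g)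
  have le: "norm (w k * e \<nu> k - w k * e \<nu>' k) \<le> w k * D" for k
    using w(2)[of k] expectation_chain_law_diff_le[where g = g and K = K and \<pi> = "\<lambda>_. \<alpha>" and \<nu> = \<nu> and k = k
      and \<nu>' = \<nu>', OF g]
    by (simp add: right_diff_distrib[symmetric] abs_mult e_def D_def mult_left_mono)
  have "\<bar>(\<Sum>k. w k * e \<nu> k) - (\<Sum>k. w k * e \<nu>' k)\<bar> = norm (\<Sum>k. w k * e \<nu> k - w k * e \<nu>' k)"
    using s by (simp add: suminf_diff)
  also have "\<dots> \<le> (\<Sum>k. w k * D)"
    using le by (intro norm_suminf_le summable_mult2 w)
  also have "\<dots> = suminf w * D"
    using w(1) by (rule suminf_mult2[symmetric])
  also have "\<dots> \<le> 1 / \<rho> * D"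
    using w(3) D by (rule mult_right_mono)
  finally show ?thesis
    by (simp add: cost_to_go_def w_def e_def D_def)
qed

context
  fixes p :: "real \<Rightarrow> 'x::finite \<Rightarrow> 'a \<Rightarrow> 'x pmf \<Rightarrow> 'x pmf"
    and f :: "'x \<Rightarrow> 'a \<Rightarrow> 'x pmf \<Rightarrow> real" and \<gamma> h C :: real
  assumes \<gamma>: "\<gamma> > 0" and h: "h > 0" and f: "\<And>x a \<mu>. \<bar>f x a \<mu>\<bar> \<le> C"
begin

text \<open>Only the values \<open>\<pi> 0 x\<close> and \<open>\<pi> (Suc k)\<close> matter for a chain started at \<open>x\<close>. This covers
  at once the stationary rule of \<open>V\<close> and the rule \<open>first_action\<close> of \<open>Q\<close>, which disagree at
  time \<open>0\<close> in states other than \<open>x\<close> even if \<open>a = \<alpha> x\<close>.\<close>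

lemma discounted_cost_eq:
  assumes \<pi>: "\<pi> 0 x = a" "\<And>k. \<pi> (Suc k) = \<alpha>"
  shows "(\<integral>\<omega>. h * (\<Sum>k. exp (- (real k * \<gamma> * h)) * f (\<omega> k) (\<pi> k (\<omega> k)) \<mu>)
      \<partial>chain_measure (\<lambda>y b. p h y b \<mu>) \<pi> (return_pmf x))
    = h * (f x a \<mu> + cost_to_go (\<gamma> * h) (\<lambda>y b. p h y b \<mu>) \<alpha> (\<lambda>y. f y (\<alpha> y) \<mu>) (p h x a \<mu>))"
    (is "?I = _")
proof -
  let ?K = "\<lambda>y b. p h y b \<mu>"
  define w where "w k = exp (- (real k * \<gamma> * h))" for k
  define E where "E k = measure_pmf.expectation (chain_law ?K \<pi> (return_pmf x) k)
    (\<lambda>y. f y (\<pi> k y) \<mu>)" for k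
  have w: "summable w" "\<And>k. 0 \<le> w k"
    using discount_sums(1)[of "\<gamma> * h"] \<gamma> h by (auto simp: w_def[abs_def] mult.assoc)
  have s: "summable (\<lambda>k. w k * E k)"
    unfolding E_def by (rule summable_weighted_bounded[OF w abs_expectation_pmf_le]) (rule f)
  have E_Suc: "E (Suc k) = measure_pmf.expectation (chain_law ?K (\<lambda>_. \<alpha>) (p h x a \<mu>) k)
      (\<lambda>y. f y (\<alpha> y) \<mu>)" for k
    unfolding E_def chain_law_Suc_shift by (simp add: \<pi> bind_return_pmf)
  have "?I = h * (\<Sum>k. w k * E k)"
    unfolding w_def[symmetric] E_def
    using integral_suminf_chain_measure[where K = ?K and \<pi> = \<pi> and \<nu> = "return_pmf x"
        and g = "\<lambda>k y. f y (\<pi> k y) \<mu>" and t = "\<lambda>k. k", OF w f]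
    by simp
  also have "(\<Sum>k. w k * E k) = w 0 * E 0 + (\<Sum>k. w (Suc k) * E (Suc k))"
    using suminf_split_head[OF s] by simp
  also have "w 0 * E 0 = f x a \<mu>"
    by (simp add: w_def E_def \<pi>)
  finally show ?thesis
    by (simp add: E_Suc cost_to_go_def w_def mult.assoc)
qed

lemma Q_MFG_eq:
  "Q_MFG p f \<gamma> h \<mu> \<alpha> x a
    = h * (f x a \<mu> + cost_to_go (\<gamma> * h) (\<lambda>y b. p h y b \<mu>) \<alpha> (\<lambda>y. f y (\<alpha> y) \<mu>) (p h x a \<mu>))"
  unfolding Q_MFG_def by (rule discounted_cost_eq) (simp_all add: first_action_def fun_eq_iff)

lemma V_MFG_eq:
  "V_MFG p f \<gamma> h \<mu> \<alpha> x
    = h * (f x (\<alpha> x) \<mu>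
        + cost_to_go (\<gamma> * h) (\<lambda>y b. p h y b \<mu>) \<alpha> (\<lambda>y. f y (\<alpha> y) \<mu>) (p h x (\<alpha> x) \<mu>))"
  unfolding V_MFG_def by (rule discounted_cost_eq) simp_all

lemma Q_MFC_eq:
  "Q_MFC p f \<gamma> h m \<alpha> x a
    = h * (f x a (m (\<alpha>(x := a)))
        + cost_to_go (\<gamma> * h) (\<lambda>y b. p h y b (m \<alpha>)) \<alpha> (\<lambda>y. f y (\<alpha> y) (m \<alpha>)) (p h x a (m \<alpha>)))"
proof -
  let ?K = "\<lambda>y b. p h y b (m \<alpha>)"
  define w where "w k = exp (- (real (Suc k) * \<gamma> * h))" for k
  have w: "summable w" "\<And>k. 0 \<le> w k"
    using discount_sums(2)[of "\<gamma> * h"] \<gamma> h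
    by (auto simp: w_def[abs_def] mult.assoc simp del: of_nat_Suc)
  have "chain_law ?K (first_action a \<alpha>) (return_pmf x) (Suc k)
      = chain_law ?K (\<lambda>_. \<alpha>) (p h x a (m \<alpha>)) k" for k
    unfolding chain_law_Suc_shift by (simp add: first_action_def[abs_def] bind_return_pmf)
  then have I: "(\<integral>\<omega>. (\<Sum>k. w k * f (\<omega> (Suc k)) (\<alpha> (\<omega> (Suc k))) (m \<alpha>))
        \<partial>chain_measure ?K (first_action a \<alpha>) (return_pmf x))
      = (\<Sum>k. w k * measure_pmf.expectation (chain_law ?K (\<lambda>_. \<alpha>) (p h x a (m \<alpha>)) k)
          (\<lambda>y. f y (\<alpha> y) (m \<alpha>)))"
    using integral_suminf_chain_measure[where K = ?K and \<pi> = "first_action a \<alpha>" and \<nu> = "return_pmf x"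
        and g = "\<lambda>k y. f y (\<alpha> y) (m \<alpha>)" and t = Suc, OF w f]
    by (simp del: chain_law.simps)
  show ?thesis
    unfolding Q_MFC_def w_def[symmetric]
    by (simp add: I first_action_def) (simp add: cost_to_go_def w_def mult.assoc distrib_left)
qed

text \<open>The law \<open>\<mu>'\<close> in the immediate cost is free: it is \<open>\<mu>\<close> in the MFG problem, and the
  limiting law of the modified policy in the MFC problem. The factor \<open>h\<close> in the hypothesis
  cancels the factor \<open>1 / (\<gamma> h)\<close> from the discounted sum.\<close>

lemma Q_minus_V_le:
  assumes K: "\<And>b y. \<bar>pmf (p h x b \<mu>) y - pmf (return_pmf x) y\<bar> \<le> B * h"
  shows "\<bar>h * (f x a \<mu>' + cost_to_go (\<gamma> * h) (\<lambda>y b. p h y b \<mu>) \<alpha> (\<lambda>y. f y (\<alpha> y) \<mu>) (p h x a \<mu>))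
      - V_MFG p f \<gamma> h \<mu> \<alpha> x\<bar> \<le> (2 * C + C / \<gamma> * (2 * B * CARD('x))) * h"
proof -
  let ?c = "cost_to_go (\<gamma> * h) (\<lambda>y b. p h y b \<mu>) \<alpha> (\<lambda>y. f y (\<alpha> y) \<mu>)"
  have C: "0 \<le> C" using f[of undefined undefined undefined] by linarith
  have d: "\<bar>pmf (p h x a \<mu>) z - pmf (p h x (\<alpha> x) \<mu>) z\<bar> \<le> 2 * B * h" for z
    using K[of a z] K[of "\<alpha> x" z] by linarith
  have "(\<Sum>z\<in>UNIV. \<bar>pmf (p h x a \<mu>) z - pmf (p h x (\<alpha> x) \<mu>) z\<bar>) \<le> CARD('x) * (2 * B * h)"
    using sum_mono[of UNIV, OF d] by simp
  then have "C / (\<gamma> * h) * (\<Sum>z\<in>UNIV. \<bar>pmf (p h x a \<mu>) z - pmf (p h x (\<alpha> x) \<mu>) z\<bar>)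
      \<le> C / (\<gamma> * h) * (CARD('x) * (2 * B * h))"
    using C \<gamma> h by (intro mult_left_mono) auto
  also have "\<dots> = C / \<gamma> * (2 * B * CARD('x))"
    using h by simp
  finally have "\<bar>?c (p h x a \<mu>) - ?c (p h x (\<alpha> x) \<mu>)\<bar> \<le> C / \<gamma> * (2 * B * CARD('x))"
    using cost_to_go_diff_le[of "\<gamma> * h" "\<lambda>y. f y (\<alpha> y) \<mu>" C "\<lambda>y b. p h y b \<mu>" \<alpha> "p h x a \<mu>" "p h x (\<alpha> x) \<mu>"]
      \<gamma> h f by simp
  then have "\<bar>(f x a \<mu>' + ?c (p h x a \<mu>)) - (f x (\<alpha> x) \<mu> + ?c (p h x (\<alpha> x) \<mu>))\<bar>
      \<le> 2 * C + C / \<gamma> * (2 * B * CARD('x))"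
    using f[of x a \<mu>'] f[of x "\<alpha> x" \<mu>] by linarith
  then show ?thesis
    using h by (simp add: V_MFG_eq right_diff_distrib[symmetric] abs_mult mult.commute)
qed

end

section \<open>Uniform bound on one transition\<close>

text \<open>The quotient is eventually within \<open>1\<close> of the generator, uniformly over \<open>S\<close>, hence
  bounded by \<open>B + 1\<close>. The set \<open>S\<close> is a singleton in the MFG problem and the set of the limiting
  laws of a policy, over all time steps, in the MFC problem.\<close>

lemma eventually_one_step_le:
  fixes p :: "real \<Rightarrow> 'x::finite \<Rightarrow> 'a::finite \<Rightarrow> 'x pmf \<Rightarrow> 'x pmf"
  assumes lim: "\<And>y b. uniform_limit S (generator_quotient p y x b) (G y x b) (at_right 0)"
    and G: "\<And>y b \<mu>. \<bar>G y x b \<mu>\<bar> \<le> B"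
  shows "\<forall>\<^sub>F h in at_right 0. h > 0 \<and> (\<forall>\<mu>\<in>S. \<forall>b y.
    \<bar>pmf (p h x b \<mu>) y - pmf (return_pmf x) y\<bar> \<le> (B + 1) * h)"
proof -
  have "\<forall>\<^sub>F h in at_right 0. \<forall>b y. \<forall>\<mu>\<in>S. dist (generator_quotient p y x b h \<mu>) (G y x b \<mu>) < 1"
    using uniform_limitD[OF lim, of 1] by (simp add: eventually_all_finite)
  then show ?thesis
    using eventually_at_right_less[of "0::real"]
  proof eventually_elim
    case (elim h)
    have "\<bar>pmf (p h x b \<mu>) y - pmf (return_pmf x) y\<bar> \<le> (B + 1) * h" if "\<mu> \<in> S" for \<mu> b y
    proof -
      have "\<bar>generator_quotient p y x b h \<mu> - G y x b \<mu>\<bar> < 1"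
        using elim that by (auto simp: dist_real_def)
      then have "\<bar>generator_quotient p y x b h \<mu>\<bar> \<le> B + 1"
        using G[of y b \<mu>] by linarith
      then show ?thesis
        using elim unfolding generator_quotient_def by (simp add: abs_divide divide_le_eq)
    qed
    with elim show ?case by blast
  qed
qed

theorem theorem3p2:
  fixes p :: "real \<Rightarrow> 'x::finite \<Rightarrow> 'a::finite \<Rightarrow> 'x pmf \<Rightarrow> 'x pmf"
    and f :: "'x \<Rightarrow> 'a \<Rightarrow> 'x pmf \<Rightarrow> real"
    and G :: "'x \<Rightarrow> 'x \<Rightarrow> 'a \<Rightarrow> 'x pmf \<Rightarrow> real"
    and \<gamma> :: real
  assumes "\<gamma> > 0"
    and "\<And>x a \<mu>. 0 \<le> f x a \<mu>"
    and "bounded (range (\<lambda>(x, a, \<mu>). f x a \<mu>))"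
    and "\<And>x' x a \<mu>. ((\<lambda>h. generator_quotient p x' x a h \<mu>) \<longlongrightarrow> G x' x a \<mu>) (at_right 0)"
    and "bounded (range (\<lambda>(x', x, a, \<mu>). G x' x a \<mu>))"
  shows "(\<forall>\<mu> \<alpha> x a.
            (\<lambda>h. Q_MFG p f \<gamma> h \<mu> \<alpha> x a - V_MFG p f \<gamma> h \<mu> \<alpha> x) \<in> O[at_right 0](\<lambda>h. h))
       \<and> (\<forall>\<nu>0 m.
            (\<forall>h>0. \<forall>\<alpha>. limiting_law (p h) \<nu>0 \<alpha> (m h \<alpha>)) \<longrightarrow>
            (\<forall>\<alpha> x' x a. uniform_limit {m h \<alpha> |h. h > 0}
               (generator_quotient p x' x a) (G x' x a) (at_right 0)) \<longrightarrow>
            (\<forall>\<alpha> x a.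
              (\<lambda>h. Q_MFC p f \<gamma> h (m h) \<alpha> x a - V_MFC p f \<gamma> h (m h) \<alpha> x) \<in> O[at_right 0](\<lambda>h. h)))"
proof -
  obtain C where C: "\<And>x a \<mu>. \<bar>f x a \<mu>\<bar> \<le> C"
    using assms(3) by (fastforce simp: bounded_iff)
  obtain B where B: "\<And>x' x a \<mu>. \<bar>G x' x a \<mu>\<bar> \<le> B"
    using assms(5) by (fastforce simp: bounded_iff)
  let ?c = "2 * C + C / \<gamma> * (2 * (B + 1) * CARD('x))"
  have MFG: "(\<lambda>h. Q_MFG p f \<gamma> h \<mu> \<alpha> x a - V_MFG p f \<gamma> h \<mu> \<alpha> x) \<in> O[at_right 0](\<lambda>h. h)" for \<mu> \<alpha> x a
  proof (rule bigoI[where c = ?c])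
    have "uniform_limit {\<mu>} (generator_quotient p y x b) (G y x b) (at_right 0)" for y b
      using assms(4) by simp
    then have "\<forall>\<^sub>F h in at_right 0. h > 0 \<and> (\<forall>\<mu>\<in>{\<mu>}. \<forall>b y.
        \<bar>pmf (p h x b \<mu>) y - pmf (return_pmf x) y\<bar> \<le> (B + 1) * h)"
      by (rule eventually_one_step_le[where G = G]) (rule B)
    then show "\<forall>\<^sub>F h in at_right 0. norm (Q_MFG p f \<gamma> h \<mu> \<alpha> x a - V_MFG p f \<gamma> h \<mu> \<alpha> x) \<le> ?c * norm h"
    proof eventually_elim
      case (elim h)
      then show ?case
        using Q_minus_V_le[where f = f and h = h and p = p and x = x and \<mu> = \<mu> and B = "B + 1" and a = a
              and \<mu>' = \<mu> and \<alpha> = \<alpha>, OF assms(1) _ C] Q_MFG_eq[OF assms(1) _ C, of h p]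
        by simp
    qed
  qed
  have MFC: "(\<lambda>h. Q_MFC p f \<gamma> h (m h) \<alpha> x a - V_MFC p f \<gamma> h (m h) \<alpha> x) \<in> O[at_right 0](\<lambda>h. h)"
    if lim: "\<And>x' x a. uniform_limit {m h \<alpha> |h. h > 0} (generator_quotient p x' x a) (G x' x a) (at_right 0)"
    for m \<alpha> x a
  proof (rule bigoI[where c = ?c])
    have "\<forall>\<^sub>F h in at_right 0. h > 0 \<and> (\<forall>\<mu>\<in>{m h \<alpha> |h. h > 0}. \<forall>b y.
        \<bar>pmf (p h x b \<mu>) y - pmf (return_pmf x) y\<bar> \<le> (B + 1) * h)"
      by (rule eventually_one_step_le[where G = G]) (rule lim B)+
    then show "\<forall>\<^sub>F h in at_right 0. norm (Q_MFC p f \<gamma> h (m h) \<alpha> x a - V_MFC p f \<gamma> h (m h) \<alpha> x)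
        \<le> ?c * norm h"
    proof eventually_elim
      case (elim h)
      have V: "V_MFC p f \<gamma> h (m h) \<alpha> x = V_MFG p f \<gamma> h (m h \<alpha>) \<alpha> x"
        by (simp add: V_MFC_def V_MFG_def)
      have "\<bar>pmf (p h x b (m h \<alpha>)) y - pmf (return_pmf x) y\<bar> \<le> (B + 1) * h" for b y
        using elim by blast
      then show ?case
        using Q_minus_V_le[where f = f and h = h and p = p and x = x and \<mu> = "m h \<alpha>" and B = "B + 1"
              and a = a and \<mu>' = "m h (\<alpha>(x := a))" and \<alpha> = \<alpha>, OF assms(1) _ C]
          Q_MFC_eq[OF assms(1) _ C, of h p] elim V
        by simp
    qed
  qed
  show ?thesis using MFG MFC by blast
qed

end
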